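(* If $\partial\Omega$ is tangent-cone graph-like (TCGL) with radius $r$, then for each $\epsilon\in(0,r)$ there exists a polygonal approximation to $\partial\Omega$ (a closed polygon) that is TCGL with radius $r-\epsilon$ and such that every point on $\partial\Omega$ is within distance $\frac{\epsilon}{6}$ of the polygon.
   Context: $\Omega\subset\mathbb{R}^2$ is a compact set whose boundary $\partial\Omega$ is a simple closed, piecewise continuously differentiable curve of length $L$. $\gamma:[0,L]\to\partial\Omega$ is a continuous arclength parameterization traversing $\partial\Omega$ counterclockwise, $\gamma(0)=\gamma(L)$, injective on $[0,L)$; the parameter is treated as periodic. $D(p,r)$ is the closed disk of radius $r$ centered at $p$. Tangent cone: $T_\gamma(s)=\{\alpha\Gamma^-+\beta\Gamma^+ \mid \alpha,\beta\ge 0,\ \alpha+\beta>0\}$, where $\Gamma^-=\lim_{t\uparrow s}\gamma'(t)$ and $\Gamma^+=\lim_{t\downarrow s}\gamma'(t)$. TCGL: a simple closed piecewise $C^1$ curve $\partial\Omega$ is tangent-cone graph-like at $p=\gamma(s)$ with radius $r$ if for every $w\in T_\gamma(s)$ and every pair of distinct points $u,v\in\partial\Omega\cap D(p,r)$ we have $\langle w,u-v\rangle\neq0$. It is TCGL with radius $r$ if this holds at every point $p$ of the curve. The same definition is applied to the polygon, using its own arclength parameterization. *)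

theory Defs
  imports "HOL-Complex_Analysis.Complex_Analysis"
begin

text \<open>
  The plane is modelled by the type \<^typ>\<open>complex\<close> with its real inner product, so that
  winding numbers are available to express orientation.  The parameter of a closed curve of
  length \<open>L\<close> is periodic: a parameterization is an \<open>L\<close>-periodic function on the whole real line,
  which determines and is determined by its restriction to \<open>{0..L}\<close>.
\<close>

text \<open>
  The library's \<^const>\<open>piecewise_C1_differentiable_on\<close> does not control the derivative near the
  exceptional points; the existence of its one-sided limits there (that is, \<open>\<gamma>\<close> being \<open>C\<^sup>1\<close> up to
  the end points of each closed piece) is required separately.  It is also what makes the
  one-sided tangents below meaningful.
\<close>

definition piecewise_C1_loop :: "(real \<Rightarrow> complex) \<Rightarrow> real \<Rightarrow> bool" where
  "piecewise_C1_loop \<gamma> L \<longleftrightarrow>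
     0 < L \<and> continuous_on UNIV \<gamma> \<and> (\<forall>t. \<gamma> (t + L) = \<gamma> t) \<and>
     \<gamma> piecewise_C1_differentiable_on {0..L} \<and>
     (\<forall>s. \<exists>l. ((\<lambda>t. vector_derivative \<gamma> (at t)) \<longlongrightarrow> l) (at_left s)) \<and>
     (\<forall>s. \<exists>l. ((\<lambda>t. vector_derivative \<gamma> (at t)) \<longlongrightarrow> l) (at_right s))"

text \<open>Since the speed is 1, the period \<open>L\<close> is the length of the curve.\<close>

definition arclength_param :: "(real \<Rightarrow> complex) \<Rightarrow> real \<Rightarrow> bool" where
  "arclength_param \<gamma> L \<longleftrightarrow>
     piecewise_C1_loop \<gamma> L \<and> inj_on \<gamma> {0..<L} \<and>
     (\<forall>t. \<gamma> differentiable (at t) \<longrightarrow> norm (vector_derivative \<gamma> (at t)) = 1)"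

definition counterclockwise :: "(real \<Rightarrow> complex) \<Rightarrow> real \<Rightarrow> bool" where
  "counterclockwise \<gamma> L \<longleftrightarrow>
     (\<forall>z\<in>inside (range \<gamma>). winding_number (\<lambda>t. \<gamma> (L * t)) z = 1)"

definition left_tangent :: "(real \<Rightarrow> complex) \<Rightarrow> real \<Rightarrow> complex" where
  "left_tangent \<gamma> s = Lim (at_left s) (\<lambda>t. vector_derivative \<gamma> (at t))"

definition right_tangent :: "(real \<Rightarrow> complex) \<Rightarrow> real \<Rightarrow> complex" where
  "right_tangent \<gamma> s = Lim (at_right s) (\<lambda>t. vector_derivative \<gamma> (at t))"

definition tangent_cone :: "(real \<Rightarrow> complex) \<Rightarrow> real \<Rightarrow> complex set" where
  "tangent_cone \<gamma> s =
     {\<alpha> *\<^sub>R left_tangent \<gamma> s + \<beta> *\<^sub>R right_tangent \<gamma> s | \<alpha> \<beta>. \<alpha> \<ge> 0 \<and> \<beta> \<ge> 0 \<and> \<alpha> + \<beta> > 0}"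

definition TCGL_at :: "(real \<Rightarrow> complex) \<Rightarrow> real \<Rightarrow> real \<Rightarrow> bool" where
  "TCGL_at \<gamma> s r \<longleftrightarrow>
     (\<forall>w \<in> tangent_cone \<gamma> s. \<forall>u \<in> range \<gamma> \<inter> cball (\<gamma> s) r. \<forall>v \<in> range \<gamma> \<inter> cball (\<gamma> s) r.
        u \<noteq> v \<longrightarrow> w \<bullet> (u - v) \<noteq> 0)"

definition TCGL :: "(real \<Rightarrow> complex) \<Rightarrow> real \<Rightarrow> bool" where
  "TCGL \<gamma> r \<longleftrightarrow> (\<forall>s. TCGL_at \<gamma> s r)"

text \<open>
  Simplicity of the polygon is not part of the following definition; it is imposed by requiring
  an injective arclength parameterization of it.
\<close>

definition closed_polygon :: "complex list \<Rightarrow> complex set" where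
  "closed_polygon vs = (\<Union>i<length vs. closed_segment (vs ! i) (vs ! (Suc i mod length vs)))"

end

theory Submission
  imports Defs
begin

text \<open>
  Every inscribed polygon with vertices \<open>\<gamma> (i * L / n)\<close> works as soon as \<open>h = L / n\<close> is at most
  \<open>\<epsilon> / 6\<close>.  A compactness argument would not give this: chords of a TCGL curve can converge to a
  direction orthogonal to a nearby tangent, for instance at an inflection point, so the inner
  products in the definition of TCGL have no uniform positive lower bound.  What saves the
  inscribed polygon is that its edges are chords of the curve, hence integrals of tangents, and
  strict inequalities between tangents and chords survive integration.

  The first ingredient concerns the curve alone.  Let \<open>q\<close> be a point of the curve.  If another curve
  point \<open>\<gamma> s\<close> lies within \<open>r\<close> of \<open>q\<close>, then TCGL at \<open>\<gamma> s\<close> says that no vector of the tangent cone is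
  orthogonal to \<open>\<gamma> s - q\<close>; so the two one-sided tangents are on the same side, and the distance to
  \<open>q\<close> has no local extremum at \<open>s\<close>.  Therefore the curve meets each disk around \<open>q\<close> of radius at most
  \<open>r\<close> in a single arc (\<open>connected_arc_in_disk\<close>), which is not the whole curve
  (\<open>curve_leaves_disk\<close>).

  On a parameter interval whose image stays in the disk of radius \<open>r\<close> around \<open>\<gamma> t\<close>, the inner product
  of \<open>\<gamma>\<close> with the right tangent at \<open>t\<close> is injective by TCGL, hence strictly monotone, and it
  increases just after \<open>t\<close>; so it is strictly increasing on the whole interval
  (\<open>right_tangent_progress\<close>).  Integrating over \<open>t\<close> gives \<open>chord_progress\<close>: two forward
  chords of the curve, one of them starting and ending near the centre of the disk, have positive
  inner product.

  For the polygon this says that every edge in the relevant arc makes an acute angle with the edge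
  under consideration.  The loss \<open>\<epsilon>\<close> of radius pays for the distances, each at most \<open>h\<close>, between
  points of the polygon, vertices and points of the curve.  A difference of two
  polygon points is a nonnegative combination of the edges between them, so it has nonzero inner
  product, of a common sign, with the one or two edges at the centre of the disk
  (\<open>edges_progress\<close>).  This is TCGL for the polygon.  Applied to two equal points it also shows that the
  polygon is simple, as its arclength parameterization has to be injective.
\<close>

section \<open>One-sided derivatives\<close>

text \<open>
  The maximum over the interval can only be attained at \<open>b\<close>.  Since only the behaviour to the right
  of each point matters, corners of a curve need no separate treatment, and neither an integral nor
  the finite set of corners appears when inequalities on tangents are passed on to chords.
\<close>

lemma less_if_increases_to_the_right:
  fixes g :: "real \<Rightarrow> real"
  assumes "a < b" and cont: "continuous_on {a..b} g"
    and step: "\<And>t. a \<le> t \<Longrightarrow> t < b \<Longrightarrow> \<exists>s. t < s \<and> s \<le> b \<and> g t < g s"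
  shows "g a < g b"
proof -
  obtain m where m: "m \<in> {a..b}" "\<And>x. x \<in> {a..b} \<Longrightarrow> g x \<le> g m"
    using continuous_attains_sup[of "{a..b}" g] \<open>a < b\<close> cont by auto
  have only: "t = b" if "t \<in> {a..b}" "g t = g m" for t
  proof (rule ccontr)
    assume "t \<noteq> b"
    with that obtain s where "t < s" "s \<le> b" "g t < g s"
      using step[of t] by auto
    with m(2)[of s] that show False by auto
  qed
  have "m = b" using only[of m] m by auto
  moreover have "g a \<noteq> g m" using only[of a] \<open>a < b\<close> by auto
  moreover have "g a \<le> g m" using m(2)[of a] \<open>a < b\<close> by auto
  ultimately show ?thesis by auto
qed

lemma less_if_right_derivative_pos:
  fixes g :: "real \<Rightarrow> real"
  assumes "a < b" and cont: "continuous_on {a..b} g"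
    and deriv: "\<And>t. a \<le> t \<Longrightarrow> t < b \<Longrightarrow> \<exists>D>0. (g has_real_derivative D) (at_right t)"
  shows "g a < g b"
proof (rule less_if_increases_to_the_right[OF assms(1,2)])
  fix t assume t: "a \<le> t" "t < b"
  then obtain D where D: "D > 0" "(g has_real_derivative D) (at_right t)"
    using deriv by blast
  then obtain d where d: "d > 0" "\<And>h. h > 0 \<Longrightarrow> t + h \<in> {t<..} \<Longrightarrow> h < d \<Longrightarrow> g t < g (t + h)"
    using has_real_derivative_pos_inc_right[OF D(2) D(1)] by blast
  define h where "h = min (d / 2) (b - t)"
  have "h > 0" "h < d" "t + h \<le> b" using d(1) t by (auto simp: h_def)
  with d(2)[of h] show "\<exists>s. t < s \<and> s \<le> b \<and> g t < g s"
    by (intro exI[of _ "t + h"]) auto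
qed

lemma derivative_near_imp_increment_near:
  fixes f :: "real \<Rightarrow> 'a::real_inner"
  assumes "x < y" "continuous_on {x..y} f"
    and "\<And>z. x < z \<Longrightarrow> z < y \<Longrightarrow> f differentiable (at z)"
    and "\<And>z. x < z \<Longrightarrow> z < y \<Longrightarrow> norm (vector_derivative f (at z) - R) \<le> e"
  shows "norm (f y - f x - (y - x) *\<^sub>R R) \<le> e * (y - x)"
proof -
  have "\<exists>z\<in>{x<..<y}. norm ((f y - y *\<^sub>R R) - (f x - x *\<^sub>R R))
          \<le> norm ((\<lambda>u. u *\<^sub>R vector_derivative f (at z) - u *\<^sub>R R) (y - x))"
  proof (rule mvt_general[OF assms(1)])
    show "continuous_on {x..y} (\<lambda>z. f z - z *\<^sub>R R)"
      by (intro continuous_intros assms)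
    fix z assume z: "x < z" "z < y"
    have "(f has_derivative (\<lambda>u. u *\<^sub>R vector_derivative f (at z))) (at z)"
      using assms(3)[OF z] by (simp add: vector_derivative_works has_vector_derivative_def)
    then show "((\<lambda>z. f z - z *\<^sub>R R) has_derivative
                 (\<lambda>u. u *\<^sub>R vector_derivative f (at z) - u *\<^sub>R R)) (at z)"
      by (auto intro!: derivative_eq_intros)
  qed
  then obtain z where z: "x < z" "z < y"
    and le: "norm ((f y - y *\<^sub>R R) - (f x - x *\<^sub>R R))
          \<le> norm ((y - x) *\<^sub>R vector_derivative f (at z) - (y - x) *\<^sub>R R)"
    by auto
  have "norm ((y - x) *\<^sub>R vector_derivative f (at z) - (y - x) *\<^sub>R R)
      = (y - x) * norm (vector_derivative f (at z) - R)"
    using \<open>x < y\<close> by (simp flip: scaleR_diff_right)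
  also have "\<dots> \<le> (y - x) * e"
    using assms(4)[OF z] \<open>x < y\<close> by (intro mult_left_mono) auto
  finally show ?thesis
    using le by (simp add: algebra_simps)
qed

text \<open>
  This and its mirror image connect the tangents, which are limits of derivatives, with the
  first-order behaviour of the curve at corners.
\<close>

lemma has_vector_derivative_at_right_of_limit:
  fixes f :: "real \<Rightarrow> 'a::real_inner"
  assumes cont: "continuous_on UNIV f"
    and diff: "eventually (\<lambda>x. f differentiable (at x)) (at_right t)"
    and lim: "((\<lambda>x. vector_derivative f (at x)) \<longlongrightarrow> R) (at_right t)"
  shows "(f has_vector_derivative R) (at_right t)"
  unfolding has_vector_derivative_def has_derivative_within_alt
proof (intro conjI allI impI)
  show "bounded_linear (\<lambda>x. x *\<^sub>R R)" by (rule bounded_linear_scaleR_left)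
  fix e :: real assume "e > 0"
  have "eventually (\<lambda>x. f differentiable (at x) \<and> dist (vector_derivative f (at x)) R < e) (at_right t)"
    by (intro eventually_conj diff tendstoD[OF lim \<open>e > 0\<close>])
  then obtain b where b: "b > t"
    "\<And>x. t < x \<Longrightarrow> x < b \<Longrightarrow> f differentiable (at x) \<and> dist (vector_derivative f (at x)) R < e"
    unfolding eventually_at_right_field by auto
  show "\<exists>d>0. \<forall>y\<in>{t<..}. norm (y - t) < d \<longrightarrow> norm (f y - f t - (y - t) *\<^sub>R R) \<le> e * norm (y - t)"
  proof (intro exI[of _ "b - t"] conjI ballI impI)
    fix y assume "y \<in> {t<..}" "norm (y - t) < b - t"
    then have y: "t < y" "y < b" by auto
    have "norm (f y - f t - (y - t) *\<^sub>R R) \<le> e * (y - t)"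
      using y b(2) by (intro derivative_near_imp_increment_near continuous_on_subset[OF cont])
        (auto simp: dist_norm less_imp_le)
    then show "norm (f y - f t - (y - t) *\<^sub>R R) \<le> e * norm (y - t)" using y by auto
  qed (use b in auto)
qed

lemma has_vector_derivative_at_left_of_limit:
  fixes f :: "real \<Rightarrow> 'a::real_inner"
  assumes cont: "continuous_on UNIV f"
    and diff: "eventually (\<lambda>x. f differentiable (at x)) (at_left t)"
    and lim: "((\<lambda>x. vector_derivative f (at x)) \<longlongrightarrow> R) (at_left t)"
  shows "(f has_vector_derivative R) (at_left t)"
  unfolding has_vector_derivative_def has_derivative_within_alt
proof (intro conjI allI impI)
  show "bounded_linear (\<lambda>x. x *\<^sub>R R)" by (rule bounded_linear_scaleR_left)
  fix e :: real assume "e > 0"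
  have "eventually (\<lambda>x. f differentiable (at x) \<and> dist (vector_derivative f (at x)) R < e) (at_left t)"
    by (intro eventually_conj diff tendstoD[OF lim \<open>e > 0\<close>])
  then obtain b where b: "b < t"
    "\<And>x. b < x \<Longrightarrow> x < t \<Longrightarrow> f differentiable (at x) \<and> dist (vector_derivative f (at x)) R < e"
    unfolding eventually_at_left_field by auto
  show "\<exists>d>0. \<forall>y\<in>{..<t}. norm (y - t) < d \<longrightarrow> norm (f y - f t - (y - t) *\<^sub>R R) \<le> e * norm (y - t)"
  proof (intro exI[of _ "t - b"] conjI ballI impI)
    fix y assume "y \<in> {..<t}" "norm (y - t) < t - b"
    then have y: "y < t" "b < y" by auto
    have "norm (f t - f y - (t - y) *\<^sub>R R) \<le> e * (t - y)"
      using y b(2) by (intro derivative_near_imp_increment_near continuous_on_subset[OF cont])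
        (auto simp: dist_norm less_imp_le)
    moreover have "f t - f y - (t - y) *\<^sub>R R = - (f y - f t - (y - t) *\<^sub>R R)"
      by (simp add: algebra_simps)
    ultimately show "norm (f y - f t - (y - t) *\<^sub>R R) \<le> e * norm (y - t)"
      using y by (simp add: norm_minus_commute)
  qed (use b in auto)
qed

lemma inner_has_real_derivative:
  fixes f :: "real \<Rightarrow> 'a::real_inner"
  assumes "(f has_vector_derivative D) (at t within S)"
  shows "((\<lambda>s. w \<bullet> f s) has_real_derivative w \<bullet> D) (at t within S)"
  using assms unfolding has_vector_derivative_def has_field_derivative_def
  by (auto intro!: derivative_eq_intros simp: fun_eq_iff)

lemma inner_increment_pos:
  fixes f :: "real \<Rightarrow> 'a::real_inner"
  assumes "continuous_on {a..b} f" "a < b"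
    and "\<And>t. a \<le> t \<Longrightarrow> t < b \<Longrightarrow> \<exists>D. (f has_vector_derivative D) (at_right t) \<and> w \<bullet> D > 0"
  shows "w \<bullet> (f b - f a) > 0"
proof -
  have "w \<bullet> f a < w \<bullet> f b"
  proof (rule less_if_right_derivative_pos[OF assms(2)])
    show "continuous_on {a..b} (\<lambda>t. w \<bullet> f t)" by (intro continuous_intros assms)
    fix t assume "a \<le> t" "t < b"
    then obtain D where "(f has_vector_derivative D) (at_right t)" "w \<bullet> D > 0"
      using assms(3) by blast
    then show "\<exists>D>0. ((\<lambda>t. w \<bullet> f t) has_real_derivative D) (at_right t)"
      using inner_has_real_derivative by blast
  qed
  then show ?thesis by (simp add: inner_diff_right)
qed

lemma norm_increment_le:
  fixes f :: "real \<Rightarrow> 'a::real_inner"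
  assumes "continuous_on {a..b} f" "a \<le> b"
    and deriv: "\<And>t. a \<le> t \<Longrightarrow> t < b \<Longrightarrow> \<exists>D. (f has_vector_derivative D) (at_right t) \<and> norm D \<le> 1"
  shows "norm (f b - f a) \<le> b - a"
proof (cases "a < b")
  case True
  \<comment> \<open>For every \<open>K > 1\<close> the function \<open>K * t - w \<bullet> f t\<close> is strictly increasing; then \<open>K\<close> tends to 1.\<close>
  define w where "w = sgn (f b - f a)"
  have "norm w \<le> 1" by (simp add: w_def norm_sgn)
  have "w \<bullet> (f b - f a) \<le> b - a"
  proof (rule field_le_epsilon)
    fix e :: real assume "e > 0"
    define K where "K = 1 + e / (b - a)"
    have "K > 1" using \<open>e > 0\<close> True by (simp add: K_def)
    have "K * a - w \<bullet> f a < K * b - w \<bullet> f b"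
    proof (rule less_if_right_derivative_pos[OF True])
      show "continuous_on {a..b} (\<lambda>t. K * t - w \<bullet> f t)"
        by (intro continuous_intros assms)
      fix t assume "a \<le> t" "t < b"
      then obtain D where D: "(f has_vector_derivative D) (at_right t)" "norm D \<le> 1"
        using deriv by blast
      have "w \<bullet> D \<le> norm w * norm D" by (rule norm_cauchy_schwarz)
      also have "\<dots> \<le> 1 * 1" using D(2) \<open>norm w \<le> 1\<close> by (intro mult_mono) auto
      finally have "K - w \<bullet> D > 0" using \<open>K > 1\<close> by simp
      moreover have "((\<lambda>t. K * t - w \<bullet> f t) has_real_derivative K - w \<bullet> D) (at_right t)"
        by (auto intro!: derivative_eq_intros inner_has_real_derivative D(1))
      ultimately show "\<exists>D>0. ((\<lambda>t. K * t - w \<bullet> f t) has_real_derivative D) (at_right t)"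
        by blast
    qed
    then have "w \<bullet> (f b - f a) < K * (b - a)"
      by (simp add: inner_diff_right algebra_simps)
    also have "\<dots> = b - a + e" using True by (simp add: K_def field_simps)
    finally show "w \<bullet> (f b - f a) \<le> b - a + e" by simp
  qed
  moreover have "w \<bullet> (f b - f a) = norm (f b - f a)"
    by (cases "f b = f a")
      (auto simp: w_def sgn_div_norm dot_square_norm power2_eq_square)
  ultimately show ?thesis by simp
qed (use assms in auto)

section \<open>Closed curves parameterized by arclength\<close>

lemma periodic_representative:
  fixes L :: real
  assumes "L > 0"
  obtains k :: int where "x \<le> y + of_int k * L" "y + of_int k * L < x + L"
proof -
  define k where "k = \<lceil>(x - y) / L\<rceil>"
  have "(x - y) / L \<le> of_int k" "of_int k < (x - y) / L + 1"
    by (auto simp: k_def) linarith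
  then have "x \<le> y + of_int k * L" "y + of_int k * L < x + L"
    using assms by (auto simp: field_simps)
  then show ?thesis by (rule that)
qed

locale arclength_loop =
  fixes \<gamma> :: "real \<Rightarrow> complex" and L :: real
  assumes arclength: "arclength_param \<gamma> L"
begin

lemma L_pos: "L > 0"
  and continuous: "continuous_on UNIV \<gamma>"
  and periodic: "\<gamma> (t + L) = \<gamma> t"
  and piecewise: "\<gamma> piecewise_C1_differentiable_on {0..L}"
  and inj: "inj_on \<gamma> {0..<L}"
  and unit_speed: "\<gamma> differentiable (at t) \<Longrightarrow> norm (vector_derivative \<gamma> (at t)) = 1"
  using arclength unfolding arclength_param_def piecewise_C1_loop_def by auto

lemma continuous_on_curve: "continuous_on S \<gamma>"
  using continuous continuous_on_subset by blast

sublocale periodic_fun_simple \<gamma> L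
  by standard (rule periodic)

lemma eq_imp_shift:
  assumes "\<gamma> s = \<gamma> t" shows "\<exists>k::int. t = s + of_int k * L"
proof -
  obtain j where j: "0 \<le> s + of_int j * L" "s + of_int j * L < 0 + L"
    using periodic_representative[OF L_pos] .
  obtain k where k: "0 \<le> t + of_int k * L" "t + of_int k * L < 0 + L"
    using periodic_representative[OF L_pos] .
  have "\<gamma> (s + of_int j * L) = \<gamma> (t + of_int k * L)"
    using assms by (simp add: plus_of_int)
  then have "s + of_int j * L = t + of_int k * L"
    using j k inj by (auto simp: inj_on_def)
  then have "t = s + of_int (j - k) * L" by (simp add: algebra_simps)
  then show ?thesis ..
qed

lemma inj_on_short_interval:
  assumes "y < x + L" shows "inj_on \<gamma> {x..y}"
proof (rule inj_onI)
  fix s t assume st: "s \<in> {x..y}" "t \<in> {x..y}" "\<gamma> s = \<gamma> t"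
  then obtain k :: int where k: "t = s + of_int k * L" using eq_imp_shift by blast
  have "\<bar>of_int k * L\<bar> < 1 * L" using st assms k by auto
  then have "\<bar>real_of_int k\<bar> < 1" using L_pos by (simp add: abs_mult)
  then have "k = 0" by linarith
  with k show "s = t" by simp
qed

lemma differentiable_shift:
  assumes "\<gamma> differentiable (at x)" shows "\<gamma> differentiable (at (x + of_int k * L))"
proof -
  have "\<gamma> = \<gamma> \<circ> (\<lambda>z. z - of_int k * L)"
    by (auto simp: fun_eq_iff minus_of_int)
  moreover have "\<gamma> \<circ> (\<lambda>z. z - of_int k * L) differentiable (at (x + of_int k * L))"
    using assms by (intro differentiable_chain_at) auto
  ultimately show ?thesis by metis
qed

lemma eventually_differentiable: "eventually (\<lambda>x. \<gamma> differentiable (at x)) (at t)"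
proof -
  obtain S where S: "finite S" "\<gamma> C1_differentiable_on ({0..L} - S)"
    using piecewise unfolding piecewise_C1_differentiable_on_def by auto
  have inside: "\<gamma> differentiable (at x)" if "x \<in> {0..L} - S" for x
    using S(2) that unfolding C1_differentiable_on_def
    by (metis differentiableI_vector)
  \<comment> \<open>The base parameter is moved into \<open>[0, L)\<close>.  Points left of 0 are compared with points left of
    \<open>L\<close>, so the exceptional set is needed together with its translate by \<open>- L\<close>.\<close>
  define S' where "S' = S \<union> (\<lambda>x. x - L) ` S"
  have "finite S'" using S(1) by (simp add: S'_def)
  obtain k where k: "0 \<le> t + of_int k * L" "t + of_int k * L < 0 + L"
    using periodic_representative[OF L_pos] .
  let ?t = "t + of_int k * L"
  have "open ({- L<..<L} - (S' - {?t}))"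
    using \<open>finite S'\<close> by (intro open_Diff finite_imp_closed) auto
  then obtain d where d: "d > 0" "ball ?t d \<subseteq> {- L<..<L} - (S' - {?t})"
    using k L_pos unfolding open_contains_ball by force
  show ?thesis unfolding eventually_at
  proof (intro exI[of _ d] conjI ballI impI)
    fix x assume x: "x \<noteq> t \<and> dist x t < d"
    let ?x = "x + of_int k * L"
    have "?x \<in> ball ?t d" using x by (simp add: dist_commute)
    with d(2) have "?x \<in> {- L<..<L} - (S' - {?t})" by blast
    then have x': "- L < ?x" "?x < L" "?x \<notin> S'" using x by auto
    have "\<gamma> differentiable (at ?x)"
    proof (cases "?x \<ge> 0")
      case True
      then show ?thesis using x' by (intro inside) (auto simp: S'_def)
    next
      case False
      have "?x + L \<notin> S"
      proof
        assume "?x + L \<in> S"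
        then have "?x \<in> (\<lambda>x. x - L) ` S" by (intro image_eqI[of _ _ "?x + L"]) auto
        then show False using x' by (simp add: S'_def)
      qed
      then have "\<gamma> differentiable (at (?x + L))"
        using False x' by (intro inside) auto
      from differentiable_shift[OF this, of "-1"] show ?thesis by simp
    qed
    from differentiable_shift[OF this, of "-k"] show "\<gamma> differentiable (at x)" by simp
  qed (use d in auto)
qed

lemma right_tangent_limit:
  "((\<lambda>t. vector_derivative \<gamma> (at t)) \<longlongrightarrow> right_tangent \<gamma> s) (at_right s)"
proof -
  obtain l where "((\<lambda>t. vector_derivative \<gamma> (at t)) \<longlongrightarrow> l) (at_right s)"
    using arclength unfolding arclength_param_def piecewise_C1_loop_def by blast
  then show ?thesis
    unfolding right_tangent_def by (metis tendsto_Lim trivial_limit_at_right_real)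
qed

lemma left_tangent_limit:
  "((\<lambda>t. vector_derivative \<gamma> (at t)) \<longlongrightarrow> left_tangent \<gamma> s) (at_left s)"
proof -
  obtain l where "((\<lambda>t. vector_derivative \<gamma> (at t)) \<longlongrightarrow> l) (at_left s)"
    using arclength unfolding arclength_param_def piecewise_C1_loop_def by blast
  then show ?thesis
    unfolding left_tangent_def by (metis tendsto_Lim trivial_limit_at_left_real)
qed

lemma has_right_tangent: "(\<gamma> has_vector_derivative right_tangent \<gamma> s) (at_right s)"
  using eventually_differentiable[of s]
  by (intro has_vector_derivative_at_right_of_limit continuous right_tangent_limit)
    (simp add: eventually_at_split)

lemma has_left_tangent: "(\<gamma> has_vector_derivative left_tangent \<gamma> s) (at_left s)"
  using eventually_differentiable[of s]
  by (intro has_vector_derivative_at_left_of_limit continuous left_tangent_limit)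
    (simp add: eventually_at_split)

lemma norm_right_tangent: "norm (right_tangent \<gamma> s) = 1"
proof (rule tendsto_unique[OF trivial_limit_at_right_real])
  show "((\<lambda>t. norm (vector_derivative \<gamma> (at t))) \<longlongrightarrow> norm (right_tangent \<gamma> s)) (at_right s)"
    by (intro tendsto_norm right_tangent_limit)
  have "eventually (\<lambda>t. \<gamma> differentiable (at t)) (at_right s)"
    using eventually_differentiable[of s] by (simp add: eventually_at_split)
  then show "((\<lambda>t. norm (vector_derivative \<gamma> (at t))) \<longlongrightarrow> 1) (at_right s)"
    by (intro tendsto_eventually) (auto elim!: eventually_mono simp: unit_speed)
qed

lemma dist_curve_le: "dist (\<gamma> s) (\<gamma> t) \<le> \<bar>s - t\<bar>"
proof -
  have *: "norm (\<gamma> y - \<gamma> x) \<le> y - x" if "x \<le> y" for x y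
    using has_right_tangent norm_right_tangent
    by (intro norm_increment_le continuous_on_curve that) (metis order.refl)
  show ?thesis
    using *[of s t] *[of t s] by (cases "s \<le> t") (auto simp: dist_norm norm_minus_commute)
qed

end

section \<open>Arcs of a TCGL curve in a disk\<close>

locale TCGL_loop = arclength_loop +
  fixes r :: real
  assumes TCGL: "TCGL \<gamma> r" and r_pos: "r > 0"
begin

lemma transversal:
  assumes "w \<in> tangent_cone \<gamma> s" "dist (\<gamma> u) (\<gamma> s) \<le> r" "dist (\<gamma> v) (\<gamma> s) \<le> r" "\<gamma> u \<noteq> \<gamma> v"
  shows "w \<bullet> (\<gamma> u - \<gamma> v) \<noteq> 0"
  using TCGL assms unfolding TCGL_def TCGL_at_def by (auto simp: dist_commute)

lemma right_tangent_in_cone: "right_tangent \<gamma> s \<in> tangent_cone \<gamma> s"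
  unfolding tangent_cone_def by (intro CollectI exI[of _ 0] exI[of _ 1]) auto

text \<open>
  If the two inner products had opposite signs, or one of them vanished, then some vector of the
  tangent cone would be orthogonal to the chord from \<open>\<gamma> p\<close> to \<open>\<gamma> s\<close>.
\<close>

lemma tangents_same_sign:
  assumes "\<gamma> s \<noteq> \<gamma> p" "dist (\<gamma> s) (\<gamma> p) \<le> r"
  shows "left_tangent \<gamma> s \<bullet> (\<gamma> s - \<gamma> p) > 0 \<and> right_tangent \<gamma> s \<bullet> (\<gamma> s - \<gamma> p) > 0 \<or>
         left_tangent \<gamma> s \<bullet> (\<gamma> s - \<gamma> p) < 0 \<and> right_tangent \<gamma> s \<bullet> (\<gamma> s - \<gamma> p) < 0"
proof -
  define a where "a = left_tangent \<gamma> s \<bullet> (\<gamma> s - \<gamma> p)"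
  define b where "b = right_tangent \<gamma> s \<bullet> (\<gamma> s - \<gamma> p)"
  have comb: "\<alpha> * a + \<beta> * b \<noteq> 0" if "\<alpha> \<ge> 0" "\<beta> \<ge> 0" "\<alpha> + \<beta> > 0" for \<alpha> \<beta>
  proof -
    have "\<alpha> *\<^sub>R left_tangent \<gamma> s + \<beta> *\<^sub>R right_tangent \<gamma> s \<in> tangent_cone \<gamma> s"
      using that unfolding tangent_cone_def by blast
    from transversal[OF this, of s p] assms r_pos show ?thesis
      by (simp add: inner_add_left a_def b_def dist_commute)
  qed
  have "a \<noteq> 0" "b \<noteq> 0" using comb[of 1 0] comb[of 0 1] by auto
  moreover have "\<not> (a > 0 \<and> b < 0)" using comb[of "- b" a] by auto
  moreover have "\<not> (a < 0 \<and> b > 0)" using comb[of b "- a"] by auto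
  ultimately show ?thesis unfolding a_def[symmetric] b_def[symmetric] by linarith
qed

text \<open>
  Both one-sided derivatives of the squared distance have the sign found in the previous lemma, so
  the distance increases strictly through \<open>s\<close> or decreases strictly through \<open>s\<close>.
\<close>

lemma distance_no_local_extremum:
  assumes "\<gamma> s \<noteq> \<gamma> p" "dist (\<gamma> s) (\<gamma> p) \<le> r" "e > 0"
  shows "(\<exists>x. \<bar>x - s\<bar> < e \<and> dist (\<gamma> x) (\<gamma> p) < dist (\<gamma> s) (\<gamma> p)) \<and>
         (\<exists>x. \<bar>x - s\<bar> < e \<and> dist (\<gamma> x) (\<gamma> p) > dist (\<gamma> s) (\<gamma> p))"
proof -
  define f where "f x = (\<gamma> x - \<gamma> p) \<bullet> (\<gamma> x - \<gamma> p)" for x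
  have f_less: "f x < f y \<longleftrightarrow> dist (\<gamma> x) (\<gamma> p) < dist (\<gamma> y) (\<gamma> p)" for x y
    unfolding f_def dist_norm by (simp add: norm_lt)
  have deriv: "(f has_real_derivative 2 * (D \<bullet> (\<gamma> s - \<gamma> p))) (at s within S)"
    if "(\<gamma> has_vector_derivative D) (at s within S)" for D S
    using that unfolding f_def has_vector_derivative_def has_field_derivative_def
    by (auto intro!: derivative_eq_intros simp: fun_eq_iff inner_commute algebra_simps)
  note right = deriv[OF has_right_tangent] and left = deriv[OF has_left_tangent]
  have wit: "\<exists>x. \<bar>x - s\<bar> < e \<and> Q x"
    if Q: "\<exists>d>0. \<forall>h>0. h < d \<longrightarrow> Q (s + h)" for Q :: "real \<Rightarrow> bool"
  proof -
    obtain d where d: "d > 0" "\<And>h. h > 0 \<Longrightarrow> h < d \<Longrightarrow> Q (s + h)" using Q by auto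
    define h where "h = min d e / 2"
    have "h > 0" "h < d" "h < e" using d(1) assms(3) by (auto simp: h_def min_def)
    with d(2)[of h] show ?thesis by (intro exI[of _ "s + h"]) auto
  qed
  have wit': "\<exists>x. \<bar>x - s\<bar> < e \<and> Q x"
    if Q: "\<exists>d>0. \<forall>h>0. h < d \<longrightarrow> Q (s - h)" for Q :: "real \<Rightarrow> bool"
  proof -
    obtain d where d: "d > 0" "\<And>h. h > 0 \<Longrightarrow> h < d \<Longrightarrow> Q (s - h)" using Q by auto
    define h where "h = min d e / 2"
    have "h > 0" "h < d" "h < e" using d(1) assms(3) by (auto simp: h_def min_def)
    with d(2)[of h] show ?thesis by (intro exI[of _ "s - h"]) auto
  qed
  from tangents_same_sign[OF assms(1,2)] show ?thesis
  proof (elim disjE conjE)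
    assume "left_tangent \<gamma> s \<bullet> (\<gamma> s - \<gamma> p) > 0" "right_tangent \<gamma> s \<bullet> (\<gamma> s - \<gamma> p) > 0"
    then show ?thesis
      using has_real_derivative_pos_inc_left[OF left] has_real_derivative_pos_inc_right[OF right]
      by (intro conjI wit wit') (auto simp: f_less)
  next
    assume "left_tangent \<gamma> s \<bullet> (\<gamma> s - \<gamma> p) < 0" "right_tangent \<gamma> s \<bullet> (\<gamma> s - \<gamma> p) < 0"
    then show ?thesis
      using has_real_derivative_neg_dec_left[OF left] has_real_derivative_neg_dec_right[OF right]
      by (intro conjI wit wit') (auto simp: f_less)
  qed
qed

text \<open>
  Of the two arcs between \<open>\<gamma> a\<close> and \<open>\<gamma> x\<close>, at least one stays in the disk: if both left it, the distance
  to \<open>\<gamma> a\<close> would have a local minimum inside the disk at a point other than \<open>\<gamma> a\<close>.  The integer selects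
  that arc, by making it the image of a parameter interval that ends at \<open>a\<close>.
\<close>

lemma connected_arc_in_disk:
  assumes "\<rho> \<le> r" "dist (\<gamma> x) (\<gamma> a) \<le> \<rho>"
  shows "\<exists>k::int. \<forall>z\<in>closed_segment a (x + of_int k * L). dist (\<gamma> z) (\<gamma> a) \<le> \<rho>"
proof -
  obtain k where k: "a \<le> x + of_int k * L" "x + of_int k * L < a + L"
    using periodic_representative[OF L_pos] .
  let ?y = "x + of_int k * L"
  let ?d = "\<lambda>z. dist (\<gamma> z) (\<gamma> a)"
  have y: "?d ?y \<le> \<rho>" using assms by (simp add: plus_of_int)
  have "(\<forall>z\<in>{a..?y}. ?d z \<le> \<rho>) \<or> (\<forall>z\<in>{?y..a + L}. ?d z \<le> \<rho>)"
  proof (rule ccontr)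
    assume "\<not> ?thesis"
    then obtain u v where uv: "a \<le> u" "u \<le> ?y" "?d u > \<rho>" "?y \<le> v" "v \<le> a + L" "?d v > \<rho>"
      by force
    have "u \<noteq> ?y" "?y \<noteq> v" using y uv by auto
    obtain m where m: "m \<in> {u..v}" "\<And>z. z \<in> {u..v} \<Longrightarrow> ?d m \<le> ?d z"
      using continuous_attains_inf[of "{u..v}" ?d] uv
      by (force intro!: continuous_intros continuous_on_curve)
    have dm: "?d m \<le> \<rho>" using m(2)[of ?y] y uv by auto
    have mi: "u < m" "m < v" using m(1) dm uv by (auto simp: less_le)
    have "\<gamma> m \<noteq> \<gamma> a"
    proof
      assume "\<gamma> m = \<gamma> a"
      then obtain j :: int where j: "m = a + of_int j * L"
        using eq_imp_shift[of a m] by auto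
      have "0 < of_int j * L" "of_int j * L < 1 * L" using mi uv j by linarith+
      then have "0 < j" "real_of_int j < 1"
        using L_pos by (auto simp: zero_less_mult_iff mult_less_cancel_right)
      then show False by linarith
    qed
    moreover have "min (m - u) (v - m) > 0" using mi by auto
    ultimately obtain z where "\<bar>z - m\<bar> < min (m - u) (v - m)" "?d z < ?d m"
      using distance_no_local_extremum[of m a "min (m - u) (v - m)"] dm assms(1)
      by (meson order_trans)
    with m(2)[of z] show False by (simp add: abs_less_iff)
  qed
  then show ?thesis
  proof
    assume "\<forall>z\<in>{a..?y}. ?d z \<le> \<rho>"
    then show ?thesis using k by (intro exI[of _ k]) (auto simp: closed_segment_eq_real_ivl)
  next
    assume *: "\<forall>z\<in>{?y..a + L}. ?d z \<le> \<rho>"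
    show ?thesis
    proof (intro exI[of _ "k - 1"] ballI)
      fix z assume "z \<in> closed_segment a (x + of_int (k - 1) * L)"
      then have "z + L \<in> {?y..a + L}" using k
        by (auto simp: closed_segment_eq_real_ivl algebra_simps split: if_splits)
      then show "?d z \<le> \<rho>" using * periodic by metis
    qed
  qed
qed

text \<open>Otherwise a farthest point of the curve from \<open>\<gamma> a\<close> would be a local maximum of the distance.\<close>

lemma curve_leaves_disk: "\<exists>x. dist (\<gamma> x) (\<gamma> a) > r"
proof (rule ccontr)
  let ?d = "\<lambda>z. dist (\<gamma> z) (\<gamma> a)"
  assume "\<not> ?thesis"
  then have all: "?d x \<le> r" for x by (auto simp: not_less)
  obtain m where m: "m \<in> {a..a + L}" "\<And>z. z \<in> {a..a + L} \<Longrightarrow> ?d z \<le> ?d m"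
    using continuous_attains_sup[of "{a..a + L}" ?d] L_pos
    by (force intro!: continuous_intros continuous_on_curve)
  have max: "?d z \<le> ?d m" for z
  proof -
    obtain k where k: "a \<le> z + of_int k * L" "z + of_int k * L < a + L"
      using periodic_representative[OF L_pos] .
    with m(2)[of "z + of_int k * L"] show ?thesis by (simp add: plus_of_int)
  qed
  have "\<gamma> (a + L / 2) \<noteq> \<gamma> a"
    using inj_onD[OF inj_on_short_interval[of "a + L / 2" a], of "a + L / 2" a] L_pos by auto
  then have "\<gamma> m \<noteq> \<gamma> a" using max[of "a + L / 2"] by auto
  then obtain z where "?d z > ?d m"
    using distance_no_local_extremum[of m a 1] all[of m] zero_less_one by blast
  with max[of z] show False by simp
qed

lemma interval_in_disk_short:
  assumes "\<And>z. z \<in> {x..y} \<Longrightarrow> dist (\<gamma> z) (\<gamma> a) \<le> r"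
  shows "y < x + L"
proof (rule ccontr)
  assume long: "\<not> ?thesis"
  obtain u where u: "dist (\<gamma> u) (\<gamma> a) > r" using curve_leaves_disk by blast
  obtain k where "x \<le> u + of_int k * L" "u + of_int k * L < x + L"
    using periodic_representative[OF L_pos] .
  then have "u + of_int k * L \<in> {x..y}" using long by auto
  from assms[OF this] u show False by (simp add: plus_of_int)
qed

text \<open>
  TCGL at \<open>\<gamma> t\<close> makes the inner product with the tangent injective on the arc, hence strictly
  monotone; its right derivative at \<open>t\<close> is the squared norm of the tangent, so it increases.
  The assumption \<open>t < y\<close> keeps a right neighbourhood of \<open>t\<close> in the interval.
\<close>

lemma right_tangent_progress:
  assumes near: "\<And>z. z \<in> {x..y} \<Longrightarrow> dist (\<gamma> z) (\<gamma> t) \<le> r"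
    and t: "x \<le> t" "t < y" and s: "s \<in> {x..y}" "s' \<in> {x..y}" "s < s'"
  shows "right_tangent \<gamma> t \<bullet> (\<gamma> s' - \<gamma> s) > 0"
proof -
  let ?w = "right_tangent \<gamma> t"
  let ?g = "\<lambda>z. ?w \<bullet> \<gamma> z"
  have "inj_on \<gamma> {x..y}"
    by (intro inj_on_short_interval interval_in_disk_short[of x y t] near)
  then have "inj_on ?g {x..y}"
    using transversal[OF right_tangent_in_cone, of _ t] near
    unfolding inj_on_def inner_diff_right by (metis right_minus_eq)
  moreover have "is_interval {x..y}" "continuous_on {x..y} ?g"
    by (auto intro!: continuous_intros continuous_on_curve simp: is_interval_cc)
  ultimately have monotone: "strict_mono_on {x..y} ?g \<or> strict_antimono_on {x..y} ?g"
    using injective_eq_monotone_map by blast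
  have "\<exists>z. t < z \<and> z \<le> y \<and> ?g t < ?g z"
  proof -
    have "?w \<bullet> ?w > 0" using norm_right_tangent[of t] by (auto simp: dot_square_norm)
    from has_real_derivative_pos_inc_right[OF inner_has_real_derivative[OF has_right_tangent] this]
    obtain d where d: "d > 0" "\<And>h. h > 0 \<Longrightarrow> h < d \<Longrightarrow> ?g t < ?g (t + h)" by auto
    define h where "h = min (d / 2) (y - t)"
    have "h > 0" "h < d" "t + h \<le> y" using d(1) t by (auto simp: h_def)
    with d(2)[of h] show ?thesis by (intro exI[of _ "t + h"]) auto
  qed
  then obtain z where z: "t < z" "z \<le> y" "?g t < ?g z" by blast
  have "\<not> strict_antimono_on {x..y} ?g"
  proof
    assume "strict_antimono_on {x..y} ?g"
    from monotone_onD[OF this, of t z] show False using t z by auto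
  qed
  then have "strict_mono_on {x..y} ?g" using monotone by blast
  from monotone_onD[OF this s] have "?g s < ?g s'" .
  then show ?thesis by (simp add: inner_diff_right)
qed

text \<open>
  Every tangent between \<open>t\<close> and \<open>t'\<close> makes progress along the chord from \<open>s\<close> to \<open>s'\<close>, hence so does
  their integral, the chord from \<open>t\<close> to \<open>t'\<close>.  The radius \<open>r - h\<close> around \<open>\<gamma> a\<close> guarantees that the
  arc lies within \<open>r\<close> of each of the points at which TCGL is used.
\<close>

lemma chord_progress:
  assumes near: "\<And>z. z \<in> {x..y} \<Longrightarrow> dist (\<gamma> z) (\<gamma> a) \<le> r - h"
    and base: "x \<le> a - h" "a + h \<le> y"
    and t: "a - h \<le> t" "t < t'" "t' \<le> a + h"
    and s: "s \<in> {x..y}" "s' \<in> {x..y}" "s < s'"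
  shows "(\<gamma> t' - \<gamma> t) \<bullet> (\<gamma> s' - \<gamma> s) > 0"
proof -
  have "(\<gamma> s' - \<gamma> s) \<bullet> (\<gamma> t' - \<gamma> t) > 0"
  proof (rule inner_increment_pos[OF continuous_on_curve t(2)])
    fix u assume u: "t \<le> u" "u < t'"
    have "dist (\<gamma> z) (\<gamma> u) \<le> r" if "z \<in> {x..y}" for z
    proof -
      have "dist (\<gamma> u) (\<gamma> a) \<le> h" using dist_curve_le[of u a] u t by auto
      then show ?thesis using near[OF that] dist_triangle2[of "\<gamma> z" "\<gamma> u" "\<gamma> a"] by auto
    qed
    then have "right_tangent \<gamma> u \<bullet> (\<gamma> s' - \<gamma> s) > 0"
      by (rule right_tangent_progress[of x y u]) (use u t base s in auto)
    then show "\<exists>D. (\<gamma> has_vector_derivative D) (at_right u) \<and> (\<gamma> s' - \<gamma> s) \<bullet> D > 0"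
      using has_right_tangent by (auto simp: inner_commute)
  qed
  then show ?thesis by (simp add: inner_commute)
qed

end

section \<open>The arclength parameterization of a closed polygon\<close>

text \<open>
  Vertices are indexed by all integers, with period \<open>n\<close>, to match the periodic curve parameter:
  going once around adds \<open>n\<close> to the index, and an arc through the starting vertex is still a
  range of consecutive indices.
\<close>

locale vertex_cycle =
  fixes P :: "int \<Rightarrow> complex" and n :: nat
  assumes n_pos: "n > 0"
    and P_periodic: "P (i + int n) = P i"
    and P_step: "P i \<noteq> P (i + 1)"
begin

definition edge :: "int \<Rightarrow> complex" where "edge i = P (i + 1) - P i"

text \<open>
  The signed length of the polygonal path from vertex 0 to vertex \<open>i\<close>; at most one of the two sums is
  nonempty.
\<close>

definition arclen :: "int \<Rightarrow> real" where
  "arclen i = (\<Sum>j\<in>{0..<i}. norm (edge j)) - (\<Sum>j\<in>{i..<0}. norm (edge j))"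

definition perimeter :: real where "perimeter = arclen (int n)"

definition edge_at :: "real \<Rightarrow> int" where
  "edge_at s = (THE i. arclen i \<le> s \<and> s < arclen (i + 1))"

definition walk :: "real \<Rightarrow> complex" where
  "walk s = P (edge_at s) + (s - arclen (edge_at s)) *\<^sub>R sgn (edge (edge_at s))"

sublocale P: periodic_fun_simple P "int n"
  by standard (rule P_periodic)

lemma edge_nonzero: "edge i \<noteq> 0"
  using P_step[of i, symmetric] by (simp add: edge_def)

lemma norm_edge_pos: "norm (edge i) > 0"
  by (simp add: edge_nonzero)

lemma edge_periodic: "edge (i + int n) = edge i"
  using P_periodic[of i] P_periodic[of "i + 1"] by (simp add: edge_def algebra_simps)

lemma arclen_0: "arclen 0 = 0"
  by (simp add: arclen_def)

lemma arclen_add_1: "arclen (i + 1) = arclen i + norm (edge i)"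
proof (cases "i \<ge> 0")
  case True
  then have "{0..<i + 1} = insert i {0..<i}" by auto
  with True show ?thesis by (simp add: arclen_def)
next
  case False
  then have "{i..<0} = insert i {i + 1..<0}" by auto
  with False show ?thesis by (simp add: arclen_def)
qed

lemma arclen_less: "i < j \<Longrightarrow> arclen i < arclen j"
proof (induction j rule: int_gr_induct)
  case base then show ?case by (simp add: arclen_add_1 edge_nonzero)
next
  case (step j) then show ?case using norm_edge_pos[of j] unfolding arclen_add_1 by linarith
qed

lemma arclen_less_iff: "arclen i < arclen j \<longleftrightarrow> i < j"
  by (metis arclen_less linorder_neqE not_less_iff_gr_or_eq)

lemma perimeter_pos: "perimeter > 0"
  using arclen_less[of 0 "int n"] n_pos by (simp add: perimeter_def arclen_0)

lemma arclen_add_n: "arclen (i + int n) = arclen i + perimeter"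
proof (induction i rule: int_induct[of _ 0])
  case base show ?case by (simp add: perimeter_def arclen_0)
next
  case (step1 i)
  have "arclen (i + 1 + int n) = arclen (i + int n) + norm (edge (i + int n))"
    using arclen_add_1[of "i + int n"] by (simp add: algebra_simps)
  then show ?case using step1 by (simp add: arclen_add_1 edge_periodic)
next
  case (step2 i)
  have "arclen (i + int n) = arclen (i - 1 + int n) + norm (edge (i - 1 + int n))"
    using arclen_add_1[of "i - 1 + int n"] by (simp add: algebra_simps)
  moreover have "arclen i = arclen (i - 1) + norm (edge (i - 1))"
    using arclen_add_1[of "i - 1"] by simp
  ultimately show ?case using step2 by (simp add: edge_periodic)
qed

lemma arclen_shift: "arclen (i + k * int n) = arclen i + of_int k * perimeter"
proof -
  \<comment> \<open>Subtracting the linear drift turns \<open>arclen\<close> into a periodic function of the index.\<close>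
  interpret p: periodic_fun_simple "\<lambda>i. arclen i - of_int i * (perimeter / of_nat n)" "int n"
    using n_pos by unfold_locales (simp add: arclen_add_n field_simps)
  have "of_int (i + k * int n) * (perimeter / of_nat n)
      = of_int i * (perimeter / of_nat n) + of_int k * perimeter"
    using n_pos by (simp add: field_simps)
  with p.plus_of_int[of i k] show ?thesis unfolding of_int_eq_id id_apply by linarith
qed

lemma edge_exists: "\<exists>i. arclen i \<le> s \<and> s < arclen (i + 1)"
proof -
  obtain k where k: "0 \<le> s + of_int k * perimeter" "s + of_int k * perimeter < 0 + perimeter"
    using periodic_representative[OF perimeter_pos] .
  let ?I = "{i \<in> {0..<int n}. arclen i \<le> s + of_int k * perimeter}"
  have fin: "finite ?I" by (rule finite_subset[of _ "{0..<int n}"]) auto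
  have "0 \<in> ?I" using k n_pos by (simp add: arclen_0)
  define i where "i = Max ?I"
  have "?I \<noteq> {}" using \<open>0 \<in> ?I\<close> by blast
  then have i: "i \<in> ?I" unfolding i_def by (rule Max_in[OF fin])
  have "s + of_int k * perimeter < arclen (i + 1)"
  proof (rule ccontr)
    assume "\<not> ?thesis"
    moreover from this have "i + 1 \<noteq> int n" using k by (auto simp: perimeter_def)
    ultimately have "i + 1 \<in> ?I" using i by auto
    then have "i + 1 \<le> i" unfolding i_def using fin by (intro Max_ge) auto
    then show False by simp
  qed
  then have "arclen (i + (- k) * int n) \<le> s \<and> s < arclen (i + (- k) * int n + 1)"
    using i arclen_shift[of i "- k"] arclen_shift[of "i + 1" "- k"] by (simp add: algebra_simps)
  then show ?thesis by blast
qed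

lemma edge_unique:
  assumes "arclen i \<le> s" "s < arclen (i + 1)" "arclen j \<le> s" "s < arclen (j + 1)"
  shows "i = j"
proof -
  have "arclen i < arclen (j + 1)" "arclen j < arclen (i + 1)" using assms by linarith+
  then show ?thesis by (simp add: arclen_less_iff)
qed

lemma edge_at_eqI: "arclen i \<le> s \<Longrightarrow> s < arclen (i + 1) \<Longrightarrow> edge_at s = i"
  unfolding edge_at_def by (rule the_equality) (auto intro: edge_unique)

lemma arclen_edge_at: "arclen (edge_at s) \<le> s" "s < arclen (edge_at s + 1)"
  using edge_exists[of s] edge_at_eqI by metis+

lemma edge_at_mono: "s \<le> t \<Longrightarrow> edge_at s \<le> edge_at t"
  using arclen_edge_at[of s] arclen_edge_at[of t] arclen_less_iff[of "edge_at s" "edge_at t + 1"] by linarith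

lemma edge_at_shift: "edge_at (s + of_int k * perimeter) = edge_at s + k * int n"
  using arclen_edge_at[of s] arclen_shift[of "edge_at s" k] arclen_shift[of "edge_at s + 1" k]
  by (intro edge_at_eqI) (simp_all add: algebra_simps)

lemma edge_shift: "edge (i + k * int n) = edge i"
  using P.plus_of_int[of i k] P.plus_of_int[of "i + 1" k] by (simp add: edge_def algebra_simps)

lemma walk_shift: "walk (s + of_int k * perimeter) = walk s"
  using P.plus_of_int[of "edge_at s" k] by (simp add: walk_def edge_at_shift edge_shift arclen_shift)

lemma walk_on_edge:
  assumes "arclen i \<le> s" "s \<le> arclen (i + 1)"
  shows "walk s = P i + (s - arclen i) *\<^sub>R sgn (edge i)"
proof (cases "s = arclen (i + 1)")
  case True
  then have "edge_at s = i + 1" by (intro edge_at_eqI) (auto simp: arclen_less_iff)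
  then have "walk s = P (i + 1)" using True by (simp add: walk_def)
  also have "\<dots> = P i + norm (edge i) *\<^sub>R sgn (edge i)"
    using norm_edge_pos[of i] by (simp add: sgn_div_norm edge_def)
  finally show ?thesis using True by (simp add: arclen_add_1)
next
  case False
  then show ?thesis using assms edge_at_eqI[of i s] by (simp add: walk_def)
qed

lemma walk_arclen: "walk (arclen i) = P i"
  using walk_on_edge[of i "arclen i"] arclen_less[of i "i + 1"] by simp

lemma dist_walk_vertex:
  assumes "arclen i \<le> s" "s \<le> arclen (i + 1)"
  shows "dist (walk s) (P i) \<le> norm (edge i)"
proof -
  have "dist (walk s) (P i) = s - arclen i"
    using assms by (simp add: walk_on_edge dist_norm norm_sgn edge_nonzero)
  then show ?thesis using assms by (simp add: arclen_add_1)
qed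

lemma edge_line_derivative:
  "((\<lambda>s. P i + (s - arclen i) *\<^sub>R sgn (edge i)) has_vector_derivative sgn (edge i)) (at s within S)"
  by (auto intro!: derivative_eq_intros)

lemma walk_derivative_right:
  assumes "arclen i \<le> s" "s < arclen (i + 1)"
  shows "(walk has_vector_derivative sgn (edge i)) (at_right s)"
proof -
  have "(walk has_vector_derivative sgn (edge i)) (at s within {s..})"
    using assms
    by (intro has_vector_derivative_transform_within[OF edge_line_derivative, of "arclen (i + 1) - s"])
      (auto simp: walk_on_edge[symmetric] dist_real_def)
  then show ?thesis by (rule has_vector_derivative_within_subset) auto
qed

lemma walk_derivative_left:
  assumes "arclen i < s" "s \<le> arclen (i + 1)"
  shows "(walk has_vector_derivative sgn (edge i)) (at_left s)"
proof -
  have "(walk has_vector_derivative sgn (edge i)) (at s within {..s})"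
    using assms
    by (intro has_vector_derivative_transform_within[OF edge_line_derivative, of "s - arclen i"])
      (auto simp: walk_on_edge[symmetric] dist_real_def)
  then show ?thesis by (rule has_vector_derivative_within_subset) auto
qed

lemma walk_derivative:
  assumes "arclen i < s" "s < arclen (i + 1)"
  shows "(walk has_vector_derivative sgn (edge i)) (at s)"
  by (rule has_vector_derivative_transform_within_open[OF edge_line_derivative, of "{arclen i<..<arclen (i + 1)}"])
    (use assms in \<open>auto simp: walk_on_edge[symmetric]\<close>)

lemma left_edge_exists: "\<exists>i. arclen i < s \<and> s \<le> arclen (i + 1)"
proof (cases "s = arclen (edge_at s)")
  case True
  then show ?thesis using arclen_less[of "edge_at s - 1" "edge_at s"]
    by (intro exI[of _ "edge_at s - 1"]) auto
next
  case False
  then show ?thesis using arclen_edge_at[of s] by (intro exI[of _ "edge_at s"]) auto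
qed

lemma continuous_walk: "continuous_on S walk"
proof -
  have "continuous (at s) walk" for s
  proof -
    obtain i where "arclen i < s" "s \<le> arclen (i + 1)" using left_edge_exists by blast
    from has_vector_derivative_continuous[OF walk_derivative_left[OF this]]
      has_vector_derivative_continuous[OF walk_derivative_right[OF arclen_edge_at[of s]]]
    show ?thesis unfolding continuous_at_split by (rule conjI)
  qed
  then show ?thesis by (intro continuous_at_imp_continuous_on) auto
qed

lemma walk_right_limit:
  assumes "arclen i \<le> s" "s < arclen (i + 1)"
  shows "((\<lambda>t. vector_derivative walk (at t)) \<longlongrightarrow> sgn (edge i)) (at_right s)"
proof (rule tendsto_eventually)
  have "eventually (\<lambda>t. t \<in> {s<..<arclen (i + 1)}) (at_right s)"
    using assms by (intro eventually_at_right_real) auto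
  then show "eventually (\<lambda>t. vector_derivative walk (at t) = sgn (edge i)) (at_right s)"
    by eventually_elim (use assms in \<open>auto intro!: vector_derivative_at walk_derivative\<close>)
qed

lemma walk_left_limit:
  assumes "arclen i < s" "s \<le> arclen (i + 1)"
  shows "((\<lambda>t. vector_derivative walk (at t)) \<longlongrightarrow> sgn (edge i)) (at_left s)"
proof (rule tendsto_eventually)
  have "eventually (\<lambda>t. t \<in> {arclen i<..<s}) (at_left s)"
    using assms by (intro eventually_at_left_real) auto
  then show "eventually (\<lambda>t. vector_derivative walk (at t) = sgn (edge i)) (at_left s)"
    by eventually_elim (use assms in \<open>auto intro!: vector_derivative_at walk_derivative\<close>)
qed

lemma right_tangent_walk:
  "arclen i \<le> s \<Longrightarrow> s < arclen (i + 1) \<Longrightarrow> right_tangent walk s = sgn (edge i)"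
  unfolding right_tangent_def by (intro tendsto_Lim walk_right_limit) auto

lemma left_tangent_walk:
  "arclen i < s \<Longrightarrow> s \<le> arclen (i + 1) \<Longrightarrow> left_tangent walk s = sgn (edge i)"
  unfolding left_tangent_def by (intro tendsto_Lim walk_left_limit) auto

lemma piecewise_C1_walk: "walk piecewise_C1_differentiable_on {0..perimeter}"
proof -
  let ?V = "arclen ` {0..int n}"
  let ?D = "\<lambda>s. sgn (edge (edge_at s))"
  have interior: "arclen (edge_at s) < s" "s < arclen (edge_at s + 1)" if s: "s \<in> {0..perimeter} - ?V" for s
  proof -
    have "arclen (int n) \<in> ?V" by (rule imageI) simp
    then have "s \<noteq> arclen (int n)" using s by blast
    then have "s < arclen (int n)" using s by (simp add: perimeter_def)
    then have "arclen (edge_at s) < arclen (int n)" "arclen 0 < arclen (edge_at s + 1)"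
      using arclen_edge_at[of s] s by (auto simp: arclen_0)
    then have vertex: "arclen (edge_at s) \<in> ?V" by (intro imageI) (simp add: arclen_less_iff)
    have "s \<noteq> arclen (edge_at s)"
    proof
      assume "s = arclen (edge_at s)"
      then have "s \<in> ?V" using vertex by (rule ssubst[where P = "\<lambda>x. x \<in> ?V"])
      with s show False by blast
    qed
    then show "arclen (edge_at s) < s" "s < arclen (edge_at s + 1)"
      using arclen_edge_at[of s] by auto
  qed
  have "continuous (at s) ?D" if s: "s \<in> {0..perimeter} - ?V" for s
  proof -
    have "eventually (\<lambda>t. t \<in> {arclen (edge_at s)<..<arclen (edge_at s + 1)}) (nhds s)"
      using interior[OF s] by (intro eventually_nhds_in_open) auto
    then have const: "eventually (\<lambda>t. ?D t = sgn (edge (edge_at s))) (nhds s)"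
      by eventually_elim (auto simp: edge_at_eqI[OF less_imp_le])
    show ?thesis unfolding isCont_cong[OF const] by simp
  qed
  then have "continuous_on ({0..perimeter} - ?V) ?D"
    by (simp add: continuous_at_imp_continuous_on)
  then have "walk C1_differentiable_on ({0..perimeter} - ?V)"
    unfolding C1_differentiable_on_def using walk_derivative[OF interior]
    by (intro exI[of _ ?D]) auto
  then show ?thesis
    unfolding piecewise_C1_differentiable_on_def using continuous_walk
    by (intro conjI exI[of _ ?V]) auto
qed

lemma arclength_param_walk:
  assumes "inj_on walk {0..<perimeter}" shows "arclength_param walk perimeter"
  unfolding arclength_param_def piecewise_C1_loop_def
proof (intro conjI allI impI)
  show "walk (t + perimeter) = walk t" for t using walk_shift[of t 1] by simp
  show "\<exists>l. ((\<lambda>t. vector_derivative walk (at t)) \<longlongrightarrow> l) (at_left s)" for s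
    using left_edge_exists[of s] walk_left_limit by blast
  show "\<exists>l. ((\<lambda>t. vector_derivative walk (at t)) \<longlongrightarrow> l) (at_right s)" for s
    using arclen_edge_at[of s] walk_right_limit by blast
  show "norm (vector_derivative walk (at t)) = 1" if "walk differentiable (at t)" for t
  proof -
    have "(walk has_vector_derivative vector_derivative walk (at t)) (at_right t)"
      using that by (simp add: vector_derivative_works has_vector_derivative_at_within)
    then have "vector_derivative walk (at t) = sgn (edge (edge_at t))"
      using walk_derivative_right[OF arclen_edge_at[of t]]
      by (intro vector_derivative_unique_within[of t "{t<..}"]) auto
    then show ?thesis by (simp add: norm_sgn edge_nonzero)
  qed
qed (use perimeter_pos continuous_walk piecewise_C1_walk assms in auto)

lemma range_walk: "range walk = closed_polygon (map (\<lambda>i. P (int i)) [0..<n])"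
proof -
  have seg: "closed_segment (P i) (P (i + 1)) = walk ` {arclen i..arclen (i + 1)}" for i
  proof (intro subset_antisym subsetI)
    fix x assume "x \<in> closed_segment (P i) (P (i + 1))"
    then obtain u where u: "0 \<le> u" "u \<le> 1" "x = P i + u *\<^sub>R edge i"
      by (auto simp: closed_segment_def edge_def algebra_simps)
    then have "u * norm (edge i) \<le> norm (edge i)" by (simp add: mult_left_le_one_le)
    with u show "x \<in> walk ` {arclen i..arclen (i + 1)}"
      using walk_on_edge[of i "arclen i + u * norm (edge i)"]
      by (intro image_eqI[of _ _ "arclen i + u * norm (edge i)"])
        (auto simp: arclen_add_1 sgn_div_norm edge_nonzero)
  next
    fix x assume "x \<in> walk ` {arclen i..arclen (i + 1)}"
    then obtain s where s: "arclen i \<le> s" "s \<le> arclen (i + 1)" "x = walk s" by auto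
    define u where "u = (s - arclen i) / norm (edge i)"
    have "0 \<le> u" "u \<le> 1" using s norm_edge_pos[of i] by (auto simp: u_def arclen_add_1)
    moreover have "x = P i + u *\<^sub>R edge i"
      using s by (simp add: walk_on_edge u_def sgn_div_norm divide_inverse mult.commute)
    ultimately show "x \<in> closed_segment (P i) (P (i + 1))"
      unfolding closed_segment_def by (auto simp: edge_def algebra_simps)
  qed
  have succ: "P (int (Suc i mod n)) = P (int i + 1)" if "i < n" for i
    using that P_periodic[of 0] by (cases "Suc i = n") (auto simp: add.commute)
  have "closed_polygon (map (\<lambda>i. P (int i)) [0..<n])
      = (\<Union>i<n. closed_segment (P (int i)) (P (int i + 1)))"
    unfolding closed_polygon_def using succ n_pos by (intro SUP_cong) auto
  also have "\<dots> = (\<Union>i<n. walk ` {arclen (int i)..arclen (int i + 1)})"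
    by (simp add: seg)
  also have "\<dots> = range walk"
  proof (intro subset_antisym subsetI)
    fix x assume "x \<in> range walk"
    then obtain s where "x = walk s" by blast
    define i where "i = nat (edge_at s mod int n)"
    define k where "k = - (edge_at s div int n)"
    have mod: "int i = edge_at s mod int n" using n_pos by (simp add: i_def)
    then have i: "int i = edge_at s + k * int n"
      by (simp add: k_def minus_div_mult_eq_mod)
    have "i < n" using mod n_pos pos_mod_bound[of "int n" "edge_at s"] by linarith
    let ?s = "s + of_int k * perimeter"
    have "edge_at ?s = int i" by (simp add: i edge_at_shift)
    then have "?s \<in> {arclen (int i)..arclen (int i + 1)}" using arclen_edge_at[of ?s] by simp
    moreover have "x = walk ?s" using \<open>x = walk s\<close> by (simp add: walk_shift)
    ultimately show "x \<in> (\<Union>i<n. walk ` {arclen (int i)..arclen (int i + 1)})"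
      using \<open>i < n\<close> by blast
  qed auto
  finally show ?thesis by simp
qed

text \<open>
  The right derivative of \<open>walk\<close> is a positive multiple of the current edge, so this needs no
  decomposition of \<open>walk t - walk s\<close> into edges.
\<close>

lemma walk_progress:
  assumes "s < t" "\<And>j. edge_at s \<le> j \<Longrightarrow> j \<le> edge_at t \<Longrightarrow> w \<bullet> edge j > 0"
  shows "w \<bullet> (walk t - walk s) > 0"
proof (rule inner_increment_pos[OF continuous_walk assms(1)])
  fix u assume "s \<le> u" "u < t"
  then have "w \<bullet> edge (edge_at u) > 0" by (intro assms(2) edge_at_mono) auto
  then have "w \<bullet> sgn (edge (edge_at u)) > 0"
    using norm_edge_pos by (simp add: sgn_div_norm)
  then show "\<exists>D. (walk has_vector_derivative D) (at_right u) \<and> w \<bullet> D > 0"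
    using walk_derivative_right[OF arclen_edge_at] by blast
qed

end

section \<open>Inscribed polygons of a TCGL curve\<close>

text \<open>
  The factor 4 accounts for three distances of at most one mesh width each, namely from a curve point
  to a vertex, from that vertex to a polygon point on the same edge, and from the centre of the disk to
  a vertex; the fourth mesh width is the margin required by \<open>chord_progress\<close>.
\<close>

locale inscribed_polygon = TCGL_loop +
  fixes n :: nat and \<epsilon> :: real
  assumes n_pos: "n > 0" and fine: "4 * (L / n) \<le> \<epsilon>" and \<epsilon>_less: "\<epsilon> < r"
begin

definition mesh :: real where "mesh = L / n"

definition vertex :: "int \<Rightarrow> complex" where "vertex i = \<gamma> (of_int i * mesh)"

lemma mesh_pos: "mesh > 0" and n_mesh: "of_nat n * mesh = L" and fine': "4 * mesh \<le> \<epsilon>"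
  using L_pos n_pos fine by (auto simp: mesh_def)

lemma near_base:
  assumes "z \<in> {a - mesh..a + mesh}" shows "dist (\<gamma> z) (\<gamma> a) \<le> r - mesh"
  using dist_curve_le[of z a] assms fine' \<epsilon>_less mesh_pos by auto

sublocale vertex_cycle vertex n
proof
  fix i :: int
  show "vertex (i + int n) = vertex i"
    using periodic[of "of_int i * mesh"] n_mesh by (simp add: vertex_def algebra_simps)
  let ?a = "of_int i * mesh"
  have "(\<gamma> (?a + mesh) - \<gamma> ?a) \<bullet> (\<gamma> (?a + mesh) - \<gamma> ?a) > 0"
    using mesh_pos near_base
    by (intro chord_progress[of "?a - mesh" "?a + mesh" ?a mesh]) auto
  then show "vertex i \<noteq> vertex (i + 1)" by (auto simp: vertex_def algebra_simps)
qed (rule n_pos)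

lemma norm_edge_le: "norm (edge i) \<le> mesh"
  using dist_curve_le[of "of_int (i + 1) * mesh" "of_int i * mesh"] mesh_pos
  by (simp add: edge_def vertex_def dist_norm algebra_simps)

lemma dist_vertex_le: "z \<in> {of_int i * mesh..of_int (i + 1) * mesh} \<Longrightarrow> dist (\<gamma> z) (vertex i) \<le> mesh"
  using dist_curve_le[of z "of_int i * mesh"] by (auto simp: vertex_def algebra_simps)

lemma edge_parameters_near:
  assumes base: "arclen i \<le> s0" "s0 \<le> arclen (i + 1)"
    and near: "dist (walk s) (walk s0) \<le> r - \<epsilon>"
    and z: "z \<in> {of_int (edge_at s) * mesh..of_int (edge_at s + 1) * mesh}"
  shows "dist (\<gamma> z) (vertex i) \<le> r - mesh"
proof -
  have "dist (\<gamma> z) (vertex (edge_at s)) \<le> mesh"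
    using z by (rule dist_vertex_le)
  moreover have "dist (walk s) (vertex (edge_at s)) \<le> mesh"
    using dist_walk_vertex[of "edge_at s" s] arclen_edge_at[of s] norm_edge_le[of "edge_at s"] by linarith
  moreover have "dist (walk s0) (vertex i) \<le> mesh"
    using dist_walk_vertex[OF base] norm_edge_le[of i] by linarith
  ultimately have "dist (\<gamma> z) (vertex i) \<le> mesh + mesh + (r - \<epsilon>) + mesh"
    using near dist_triangle2[of "\<gamma> z" "walk s" "vertex (edge_at s)"]
      dist_triangle[of "\<gamma> z" "vertex i" "walk s"]
      dist_triangle[of "walk s" "vertex i" "walk s0"] by linarith
  then show ?thesis using fine' by linarith
qed

text \<open>
  The parameters \<open>s\<close> and \<open>s + k * perimeter\<close> describe the same polygon point; \<open>k\<close> is chosen so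
  that the curve, between the base vertex and the far end of the edge of that point, stays in
  the disk.  Such an arc exists because the curve meets the disk in a single arc.
\<close>

lemma shift_into_base_arc:
  assumes base: "arclen i \<le> s0" "s0 \<le> arclen (i + 1)"
    and near: "dist (walk s) (walk s0) \<le> r - \<epsilon>"
  shows "\<exists>k::int. \<forall>z. let a = of_int i * mesh; j = edge_at (s + of_int k * perimeter) in
           min a (of_int j * mesh) \<le> z \<and> z \<le> max a (of_int (j + 1) * mesh) \<longrightarrow>
           dist (\<gamma> z) (\<gamma> a) \<le> r - mesh"
proof -
  let ?a = "of_int i * mesh"
  have "of_int (edge_at s) * mesh \<in> {of_int (edge_at s) * mesh..of_int (edge_at s + 1) * mesh}"
    using mesh_pos by auto
  from edge_parameters_near[OF base near this]
  have start: "dist (\<gamma> (of_int (edge_at s) * mesh)) (\<gamma> ?a) \<le> r - mesh"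
    by (simp add: vertex_def)
  have "r - mesh \<le> r" using mesh_pos by simp
  from connected_arc_in_disk[OF this start] obtain k :: int
    where k: "\<forall>z\<in>closed_segment ?a (of_int (edge_at s) * mesh + of_int k * L).
                  dist (\<gamma> z) (\<gamma> ?a) \<le> r - mesh"
    by (rule exE)
  define s' where "s' = s + of_int k * perimeter"
  have j: "of_int (edge_at s) * mesh + of_int k * L = of_int (edge_at s') * mesh"
    unfolding s'_def edge_at_shift by (simp add: distrib_right mult.assoc n_mesh)
  have "dist (walk s') (walk s0) \<le> r - \<epsilon>" using near by (simp add: s'_def walk_shift)
  \<comment> \<open>The chosen arc only reaches the first vertex of the edge; the rest of the edge is near anyway.\<close>
  note last = edge_parameters_near[OF base this]
  have "dist (\<gamma> z) (\<gamma> ?a) \<le> r - mesh"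
    if "min ?a (of_int (edge_at s') * mesh) \<le> z" "z \<le> max ?a (of_int (edge_at s' + 1) * mesh)" for z
  proof (cases "z \<in> closed_segment ?a (of_int (edge_at s') * mesh)")
    case True
    then show ?thesis using k by (simp add: j)
  next
    case False
    then have "z \<in> {of_int (edge_at s') * mesh..of_int (edge_at s' + 1) * mesh}"
      using that mesh_pos by (auto simp: closed_segment_eq_real_ivl split: if_splits)
    from last[OF this] show ?thesis by (simp add: vertex_def)
  qed
  then show ?thesis unfolding Let_def s'_def by blast
qed

text \<open>
  Two polygon points near \<open>walk s0\<close> are moved to parameters in the same arc around the base vertex
  \<open>i\<close>.  All edges between them then have positive inner product with both edges at that vertex.
  Both edges are treated with the same \<open>k\<close> and \<open>l\<close>, since at a vertex the tangent cone mixes them and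
  the two signs have to agree.
\<close>

lemma edges_progress:
  assumes base: "arclen i \<le> s0" "s0 \<le> arclen (i + 1)"
    and "dist (walk s) (walk s0) \<le> r - \<epsilon>" "dist (walk t) (walk s0) \<le> r - \<epsilon>"
  shows "\<exists>k l :: int. let s' = s + of_int k * perimeter; t' = t + of_int l * perimeter in
     \<forall>e\<in>{i - 1, i}. (s' < t' \<longrightarrow> edge e \<bullet> (walk t - walk s) > 0) \<and>
                     (t' < s' \<longrightarrow> edge e \<bullet> (walk t - walk s) < 0)"
proof -
  let ?a = "of_int i * mesh"
  obtain k l :: int where kl:
    "\<And>z. min ?a (of_int (edge_at (s + of_int k * perimeter)) * mesh) \<le> z \<Longrightarrow>
         z \<le> max ?a (of_int (edge_at (s + of_int k * perimeter) + 1) * mesh) \<Longrightarrow> dist (\<gamma> z) (\<gamma> ?a) \<le> r - mesh"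
    "\<And>z. min ?a (of_int (edge_at (t + of_int l * perimeter)) * mesh) \<le> z \<Longrightarrow>
         z \<le> max ?a (of_int (edge_at (t + of_int l * perimeter) + 1) * mesh) \<Longrightarrow> dist (\<gamma> z) (\<gamma> ?a) \<le> r - mesh"
    using shift_into_base_arc[OF base assms(3)] shift_into_base_arc[OF base assms(4)] unfolding Let_def by blast
  define s' where "s' = s + of_int k * perimeter"
  define t' where "t' = t + of_int l * perimeter"
  note kl = kl[folded s'_def t'_def]
  define x where "x = min (?a - mesh) (min (of_int (edge_at s') * mesh) (of_int (edge_at t') * mesh))"
  define y where "y = max (?a + mesh) (max (of_int (edge_at s' + 1) * mesh) (of_int (edge_at t' + 1) * mesh))"
  have near: "dist (\<gamma> z) (\<gamma> ?a) \<le> r - mesh" if "z \<in> {x..y}" for z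
  proof -
    consider "z \<in> {?a - mesh..?a + mesh}" | "z < ?a - mesh" | "?a + mesh < z" by force
    then show ?thesis
    proof cases
      case 1
      then show ?thesis by (rule near_base)
    next
      case 2
      then have "of_int (edge_at s') * mesh \<le> z \<or> of_int (edge_at t') * mesh \<le> z"
        using that unfolding x_def by auto
      with 2 mesh_pos show ?thesis by (elim disjE) (intro kl; linarith)+
    next
      case 3
      then have "z \<le> of_int (edge_at s' + 1) * mesh \<or> z \<le> of_int (edge_at t' + 1) * mesh"
        using that unfolding y_def by auto
      with 3 mesh_pos show ?thesis by (elim disjE) (intro kl; linarith)+
    qed
  qed
  have pos: "edge e \<bullet> edge j > 0"
    if e: "e \<in> {i - 1, i}" and j: "min (edge_at s') (edge_at t') \<le> j" "j \<le> max (edge_at s') (edge_at t')" for e j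
  proof -
    have "of_int (edge_at s') * mesh \<le> of_int j * mesh \<or> of_int (edge_at t') * mesh \<le> of_int j * mesh"
      using j(1) mesh_pos by (auto simp: min_le_iff_disj)
    then have x: "x \<le> of_int j * mesh" unfolding x_def by linarith
    have "of_int (j + 1) * mesh \<le> of_int (edge_at s' + 1) * mesh \<or>
          of_int (j + 1) * mesh \<le> of_int (edge_at t' + 1) * mesh"
      using j(2) mesh_pos by (auto simp: le_max_iff_disj)
    then have y: "of_int (j + 1) * mesh \<le> y" unfolding y_def by linarith
    have "(\<gamma> (of_int (e + 1) * mesh) - \<gamma> (of_int e * mesh)) \<bullet>
          (\<gamma> (of_int (j + 1) * mesh) - \<gamma> (of_int j * mesh)) > 0"
    proof (rule chord_progress[of x y ?a mesh])
      show "x \<le> ?a - mesh" "?a + mesh \<le> y" by (auto simp: x_def y_def)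
    qed (use near e x y mesh_pos in \<open>auto simp: algebra_simps\<close>)
    then show ?thesis by (simp add: edge_def vertex_def)
  qed
  have "edge e \<bullet> (walk t' - walk s') > 0" if "s' < t'" "e \<in> {i - 1, i}" for e
    using that pos by (intro walk_progress) (auto simp: min_le_iff_disj le_max_iff_disj)
  moreover have "edge e \<bullet> (walk s' - walk t') > 0" if "t' < s'" "e \<in> {i - 1, i}" for e
    using that pos by (intro walk_progress) (auto simp: min_le_iff_disj le_max_iff_disj)
  moreover have "walk s' = walk s" "walk t' = walk t" by (simp_all add: s'_def t'_def walk_shift)
  ultimately have "\<forall>e\<in>{i - 1, i}. (s' < t' \<longrightarrow> edge e \<bullet> (walk t - walk s) > 0) \<and>
                     (t' < s' \<longrightarrow> edge e \<bullet> (walk t - walk s) < 0)"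
    by (simp add: inner_diff_right)
  then show ?thesis unfolding Let_def s'_def t'_def by (intro exI)
qed

text \<open>
  Equal points would make a chord with zero inner product, so their parameters coincide after
  translation by multiples of the perimeter.
\<close>

lemma inj_on_walk: "inj_on walk {0..<perimeter}"
proof (rule inj_onI)
  fix s t assume s: "s \<in> {0..<perimeter}" and t: "t \<in> {0..<perimeter}" and eq: "walk s = walk t"
  have "dist (walk s) (walk s) \<le> r - \<epsilon>" "dist (walk t) (walk s) \<le> r - \<epsilon>"
    using eq \<epsilon>_less by simp_all
  from edges_progress[OF arclen_edge_at(1) less_imp_le[OF arclen_edge_at(2)] this]
  obtain k l :: int where kl: "\<not> s + of_int k * perimeter < t + of_int l * perimeter"
    "\<not> t + of_int l * perimeter < s + of_int k * perimeter"
    unfolding Let_def eq by auto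
  then have d: "s - t = of_int (l - k) * perimeter" by (simp add: algebra_simps)
  have "\<bar>of_int (l - k) * perimeter\<bar> < 1 * perimeter" unfolding d[symmetric] using s t by auto
  then have "\<bar>real_of_int (l - k)\<bar> < 1"
    using perimeter_pos by (simp only: abs_mult mult_less_cancel_right_pos abs_of_pos)
  then have "l - k = 0" by linarith
  with d show "s = t" by simp
qed

text \<open>
  Both tangents at a polygon point are directions of edges at one vertex, and
  \<open>edges_progress\<close> gives their inner products with \<open>u - v\<close> the same sign; so no vector of the cone is
  orthogonal to \<open>u - v\<close>.
\<close>

lemma TCGL_walk: "TCGL walk (r - \<epsilon>)"
  unfolding TCGL_def TCGL_at_def
proof (intro allI ballI impI)
  fix s0 w u v
  assume w: "w \<in> tangent_cone walk s0" and u: "u \<in> range walk \<inter> cball (walk s0) (r - \<epsilon>)"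
    and v: "v \<in> range walk \<inter> cball (walk s0) (r - \<epsilon>)" and "u \<noteq> v"
  from u obtain t where t: "u = walk t" "dist (walk t) (walk s0) \<le> r - \<epsilon>"
    by (auto simp: dist_commute)
  from v obtain s where s: "v = walk s" "dist (walk s) (walk s0) \<le> r - \<epsilon>"
    by (auto simp: dist_commute)
  define i where "i = edge_at s0"
  have i: "arclen i \<le> s0" "s0 < arclen (i + 1)" using arclen_edge_at[of s0] by (auto simp: i_def)
  obtain k l :: int where kl: "\<And>e. e \<in> {i - 1, i} \<Longrightarrow>
      (s + of_int k * perimeter < t + of_int l * perimeter \<longrightarrow> edge e \<bullet> (u - v) > 0) \<and>
      (t + of_int l * perimeter < s + of_int k * perimeter \<longrightarrow> edge e \<bullet> (u - v) < 0)"
    using edges_progress[OF i(1) less_imp_le[OF i(2)] s(2) t(2)] unfolding Let_def s t by blast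
  have ne: "s + of_int k * perimeter \<noteq> t + of_int l * perimeter"
    using \<open>u \<noteq> v\<close> walk_shift[of s k] walk_shift[of t l] s t by metis
  have sgn_pos: "sgn (edge e) \<bullet> z > 0 \<longleftrightarrow> edge e \<bullet> z > 0"
    and sgn_neg: "sgn (edge e) \<bullet> z < 0 \<longleftrightarrow> edge e \<bullet> z < 0" for e z
    using norm_edge_pos[of e] by (auto simp: sgn_div_norm zero_less_mult_iff mult_less_0_iff)
  have right: "right_tangent walk s0 = sgn (edge i)" using i by (rule right_tangent_walk)
  have left: "\<exists>e\<in>{i - 1, i}. left_tangent walk s0 = sgn (edge e)"
  proof (cases "s0 = arclen i")
    case True
    then show ?thesis using left_tangent_walk[of "i - 1" s0] arclen_less[of "i - 1" i] by auto
  next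
    case False
    then show ?thesis using left_tangent_walk[of i s0] i by auto
  qed
  obtain e where e: "e \<in> {i - 1, i}" "left_tangent walk s0 = sgn (edge e)" using left by blast
  from w right e(2) obtain \<alpha> \<beta> where ab: "\<alpha> \<ge> 0" "\<beta> \<ge> 0" "\<alpha> + \<beta> > 0"
    "w = \<alpha> *\<^sub>R sgn (edge e) + \<beta> *\<^sub>R sgn (edge i)"
    unfolding tangent_cone_def by auto
  define p where "p = sgn (edge e) \<bullet> (u - v)"
  define q where "q = sgn (edge i) \<bullet> (u - v)"
  have "p > 0 \<and> q > 0 \<or> p < 0 \<and> q < 0"
    using kl[OF e(1)] kl[of i] ne unfolding p_def q_def sgn_pos sgn_neg by (auto simp: neq_iff)
  moreover have "w \<bullet> (u - v) = \<alpha> * p + \<beta> * q"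
    by (simp add: ab(4) inner_add_left p_def q_def)
  moreover have "\<alpha> > 0 \<or> \<beta> > 0" using ab by linarith
  ultimately show "w \<bullet> (u - v) \<noteq> 0"
    using ab(1,2) by (smt (verit) mult_nonneg_nonneg mult_pos_pos mult_nonneg_nonpos mult_pos_neg)
qed

lemma curve_near_polygon: "\<exists>y\<in>range walk. dist (\<gamma> t) y \<le> mesh"
proof -
  define i where "i = \<lfloor>t / mesh\<rfloor>"
  have "of_int i \<le> t / mesh" "t / mesh \<le> of_int i + 1" unfolding i_def by linarith+
  then have "t \<in> {of_int i * mesh..of_int (i + 1) * mesh}"
    using mesh_pos by (auto simp: field_simps)
  then have "dist (\<gamma> t) (walk (arclen i)) \<le> mesh" unfolding walk_arclen by (rule dist_vertex_le)
  then show ?thesis by blast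
qed

end

theorem lemma20:
  fixes \<Omega> :: "complex set" and \<gamma> :: "real \<Rightarrow> complex" and L r \<epsilon> :: real
  assumes "compact \<Omega>"
    and "arclength_param \<gamma> L"
    and "counterclockwise \<gamma> L"
    and "frontier \<Omega> = range \<gamma>"
    and "TCGL \<gamma> r"
    and "0 < \<epsilon>" and "\<epsilon> < r"
  shows "\<exists>vs \<eta> M. arclength_param \<eta> M \<and> range \<eta> = closed_polygon vs \<and>
           TCGL \<eta> (r - \<epsilon>) \<and>
           (\<forall>x\<in>frontier \<Omega>. \<exists>y\<in>closed_polygon vs. dist x y \<le> \<epsilon> / 6)"
proof -
  interpret arclength_loop \<gamma> L using assms by unfold_locales
  obtain n :: nat where n: "6 * L / \<epsilon> < real n" using reals_Archimedean2 by blast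
  have "0 < 6 * L / \<epsilon>" using L_pos \<open>0 < \<epsilon>\<close> by simp
  with n have "n > 0" by (metis of_nat_0_less_iff less_trans)
  have h: "L / n \<le> \<epsilon> / 6" using n \<open>n > 0\<close> \<open>0 < \<epsilon>\<close> by (simp add: field_simps)
  interpret inscribed_polygon \<gamma> L r n \<epsilon>
    using assms h \<open>n > 0\<close> by unfold_locales auto
  show ?thesis
  proof (intro exI conjI ballI)
    show "arclength_param walk perimeter" by (rule arclength_param_walk[OF inj_on_walk])
    show "range walk = closed_polygon (map (\<lambda>i. vertex (int i)) [0..<n])" by (rule range_walk)
    show "TCGL walk (r - \<epsilon>)" by (rule TCGL_walk)
    fix x assume "x \<in> frontier \<Omega>"
    then obtain t where "x = \<gamma> t" using assms(4) by auto
    obtain y where y: "y \<in> range walk" "dist (\<gamma> t) y \<le> mesh" using curve_near_polygon[of t] by blast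
    have "dist x y \<le> \<epsilon> / 6" using y(2) h unfolding mesh_def \<open>x = \<gamma> t\<close> by linarith
    with y(1) show "\<exists>y\<in>closed_polygon (map (\<lambda>i. vertex (int i)) [0..<n]). dist x y \<le> \<epsilon> / 6"
      unfolding range_walk by blast
  qed
qed

end
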